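(* $\operatorname{cov}(\mathcal{M})\le w\mathfrak{S}$, where $\mathcal{M}$ is the ideal of meager subsets of the reals.
   Context: A partition of $\omega$ is a set of pairwise disjoint nonempty subsets of $\omega$ (blocks) with union $\omega$. $(\omega)^\omega$ is the set of partitions with infinitely many blocks, $(\omega)^\omega_\infty$ those with at least one infinite block. $X\sqsubseteq Y$ means every block of $X$ is a union of blocks of $Y$; $X\sqcup Y$ is the finest partition coarser than both. For finite $f\subseteq\omega$, $X\sqcup\{f\}$ is the finest partition coarser than $X$ with $f$ inside one block; $X\sqsubseteq^*Y$ iff $X\sqcup\{f\}\sqsubseteq Y$ for some finite $f$; $X\approx Y$ iff both directions hold; $X$ is trivial if $X\approx$ the partition into singletons. $X_1,X_2\in(\omega)^\omega$ are compatible if $X_1\sqcup X_2\in(\omega)^\omega$, orthogonal ($X_1\perp X_2$) if $X_1\sqcup X_2$ has the single block $\omega$. $X_1$ splits $X_2$ if they are compatible and some $Y\in(\omega)^\omega$ with $Y\sqsubseteq X_2$ satisfies $X_1\perp Y$. For a non-trivial $X\in(\omega)^\omega$, enumerate its blocks in order of their least elements, each block ordered naturally, and define $X^\perp$: if $X\in(\omega)^\omega_\infty$, $n$ lies in the $i$-th block of $X^\perp$ iff $n$ is the $i$-th element of some block of $X$; otherwise $X^\perp$ is the partition whose blocks are the set of least elements of blocks of $X$ together with singletons of all other numbers. A family $\mathcal{W}\subseteq(\omega)^\omega_\infty$ is weak splitting if for every non-trivial $X\in(\omega)^\omega$ there is $W\in\mathcal{W}$ which splits $X$ or splits $X^\perp$;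 $w\mathfrak{S}$ is the least size of a weak splitting family. *)

theory Defs
  imports "HOL-Analysis.Analysis"
begin

unbundle cardinal_syntax

section \<open>Partitions of the natural numbers\<close>

definition omega_partitions :: "nat set set set" where
  "omega_partitions = {X. partition_on UNIV X \<and> infinite X}"

definition omega_partitions_inf :: "nat set set set" where
  "omega_partitions_inf = {X \<in> omega_partitions. \<exists>b\<in>X. infinite b}"

definition coarser :: "nat set set \<Rightarrow> nat set set \<Rightarrow> bool"  (infix "\<sqsubseteq>\<^sub>p" 50) where
  "X \<sqsubseteq>\<^sub>p Y \<longleftrightarrow> (\<forall>b\<in>X. \<exists>S\<subseteq>Y. b = \<Union>S)"

definition finest :: "(nat set set \<Rightarrow> bool) \<Rightarrow> nat set set" where
  "finest P = (THE Z. partition_on UNIV Z \<and> P Z \<and>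
                 (\<forall>Z'. partition_on UNIV Z' \<and> P Z' \<longrightarrow> Z' \<sqsubseteq>\<^sub>p Z))"

definition join :: "nat set set \<Rightarrow> nat set set \<Rightarrow> nat set set"  (infixl "\<squnion>\<^sub>p" 65) where
  "X \<squnion>\<^sub>p Y = finest (\<lambda>Z. Z \<sqsubseteq>\<^sub>p X \<and> Z \<sqsubseteq>\<^sub>p Y)"

(* The partition written X \<squnion> {f} for a finite set f of naturals. *)
definition glue :: "nat set set \<Rightarrow> nat set \<Rightarrow> nat set set" where
  "glue X f = finest (\<lambda>Z. Z \<sqsubseteq>\<^sub>p X \<and> (\<exists>b\<in>Z. f \<subseteq> b))"

definition almost_coarser :: "nat set set \<Rightarrow> nat set set \<Rightarrow> bool"  (infix "\<sqsubseteq>\<^sup>*" 50) where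
  "X \<sqsubseteq>\<^sup>* Y \<longleftrightarrow> (\<exists>f. finite f \<and> glue X f \<sqsubseteq>\<^sub>p Y)"

definition almost_equal :: "nat set set \<Rightarrow> nat set set \<Rightarrow> bool"  (infix "\<approx>\<^sub>p" 50) where
  "X \<approx>\<^sub>p Y \<longleftrightarrow> X \<sqsubseteq>\<^sup>* Y \<and> Y \<sqsubseteq>\<^sup>* X"

definition trivial_partition :: "nat set set \<Rightarrow> bool" where
  "trivial_partition X \<longleftrightarrow> X \<approx>\<^sub>p range (\<lambda>n. {n})"

definition compatible :: "nat set set \<Rightarrow> nat set set \<Rightarrow> bool" where
  "compatible X Y \<longleftrightarrow> X \<squnion>\<^sub>p Y \<in> omega_partitions"

definition orthogonal_partitions :: "nat set set \<Rightarrow> nat set set \<Rightarrow> bool"  (infix "\<bottom>\<^sub>p" 50) where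
  "X \<bottom>\<^sub>p Y \<longleftrightarrow> X \<squnion>\<^sub>p Y = {UNIV}"

definition splits :: "nat set set \<Rightarrow> nat set set \<Rightarrow> bool" where
  "splits X Y \<longleftrightarrow> compatible X Y \<and> (\<exists>Z\<in>omega_partitions. Z \<sqsubseteq>\<^sub>p Y \<and> X \<bottom>\<^sub>p Z)"

(* The i-th element of b is the n in b with exactly i predecessors in b, counting from 0;
   a finite block has no i-th element for i at least its size. *)
definition perp :: "nat set set \<Rightarrow> nat set set" where
  "perp X =
     (if \<exists>b\<in>X. infinite b
      then range (\<lambda>i. {n. \<exists>b\<in>X. n \<in> b \<and> card {m\<in>b. m < n} = i})
      else (let L = (\<lambda>b. LEAST n. n \<in> b) ` X in insert L ((\<lambda>n. {n}) ` (UNIV - L))))"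

definition weak_splitting :: "nat set set set \<Rightarrow> bool" where
  "weak_splitting W \<longleftrightarrow> W \<subseteq> omega_partitions_inf \<and>
     (\<forall>X\<in>omega_partitions. \<not> trivial_partition X \<longrightarrow>
        (\<exists>Y\<in>W. splits Y X \<or> splits Y (perp X)))"

section \<open>Meager sets and the two cardinal invariants\<close>

definition nowhere_dense :: "'a::topological_space set \<Rightarrow> bool" where
  "nowhere_dense A \<longleftrightarrow> interior (closure A) = {}"

definition meager :: "'a::topological_space set \<Rightarrow> bool" where
  "meager A \<longleftrightarrow> (\<exists>N. countable N \<and> (\<forall>B\<in>N. nowhere_dense B) \<and> A = \<Union>N)"

(* Cardinals are the well-order relations of BNF_Cardinal_Order_Relation.  Since the ordering of
   cardinalities is well-founded, a member of minimal size exists whenever the collection C is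
   nonempty. *)
definition least_size :: "'a set set \<Rightarrow> 'a rel" where
  "least_size C = |SOME A. A \<in> C \<and> (\<forall>B\<in>C. |A| \<le>o |B| )|"

definition cov_meager :: "real set rel" where
  "cov_meager = least_size {F. (\<forall>A\<in>F. meager A) \<and> \<Union>F = UNIV}"

definition weak_splitting_number :: "nat set set rel" where
  "weak_splitting_number = least_size {W. weak_splitting W}"

end

theory Submission
  imports Defs
begin

text \<open>
  Read a sequence \<open>f\<close> of natural numbers off the binary digits of a real \<open>x\<close>, and let \<open>X\<close> be
  the partition of the natural numbers into the fibres of \<open>f\<close>.  If \<open>B\<close> is an infinite block of
  \<open>Y\<close>, then for all \<open>x\<close> outside a meager set every block of \<open>X\<close> meets \<open>B\<close>, and so does every
  block of \<open>perp X\<close>.  Hence the joins of \<open>Y\<close> with \<open>X\<close> and with \<open>perp X\<close> are the one-block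
  partition, and \<open>Y\<close> splits neither.  So the meager sets belonging to the members of a weak
  splitting family cover the real line.
\<close>

section \<open>Partitions into fibres\<close>

text \<open>Every infinite partition arises this way from a surjection numbering its blocks;
  surjectivity keeps the empty set from occurring as a fibre.\<close>

definition fibers :: "(nat \<Rightarrow> nat) \<Rightarrow> nat set set" where
  "fibers h = range (\<lambda>v. h -` {v})"

lemma fibers_omega_partition:
  assumes "surj h"
  shows "fibers h \<in> omega_partitions"
proof -
  have ne: "h -` {v} \<noteq> {}" for v
    using assms by (metis empty_iff surjD vimage_singleton_eq)
  have "inj (\<lambda>v. h -` {v})"
    using ne by (metis (mono_tags, lifting) equals0I injI vimage_singleton_eq)
  then have "infinite (fibers h)"
    unfolding fibers_def by (simp add: finite_image_iff)
  moreover have "partition_on UNIV (fibers h)"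
    unfolding partition_on_def disjoint_def fibers_def using ne by fastforce
  ultimately show ?thesis
    by (simp add: omega_partitions_def)
qed

section \<open>Blocks, the coarsening order and joins\<close>

lemma partition_block_nonempty: "partition_on A Z \<Longrightarrow> z \<in> Z \<Longrightarrow> \<exists>n. n \<in> z"
  unfolding partition_on_def by (metis ex_in_conv)

lemma partition_block_unique:
  "partition_on A Z \<Longrightarrow> z \<in> Z \<Longrightarrow> y \<in> Z \<Longrightarrow> n \<in> z \<Longrightarrow> n \<in> y \<Longrightarrow> z = y"
  unfolding partition_on_def disjoint_def by (metis disjoint_iff)

lemma partition_block_ex: "partition_on UNIV Z \<Longrightarrow> \<exists>z\<in>Z. n \<in> z"
  unfolding partition_on_def by (metis UNIV_I UnionE)

text \<open>By disjointness, \<open>y\<close> is the block through \<open>n\<close> among the blocks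
  of \<open>Y\<close> whose union is \<open>z\<close>.\<close>

lemma coarser_block_subset:
  assumes "Z \<sqsubseteq>\<^sub>p Y" "partition_on UNIV Z" "partition_on UNIV Y" "z \<in> Z" "y \<in> Y" "n \<in> z" "n \<in> y"
  shows "y \<subseteq> z"
proof -
  obtain S where S: "S \<subseteq> Y" "z = \<Union>S"
    using assms(1,4) unfolding coarser_def by blast
  then obtain b where b: "b \<in> S" "n \<in> b"
    using assms(6) by blast
  then have "b = y"
    using partition_block_unique[OF assms(3), of b y n] S assms(5,7) by blast
  then show ?thesis using S b by blast
qed

lemma coarser_antisym:
  assumes "Z \<sqsubseteq>\<^sub>p Y" "Y \<sqsubseteq>\<^sub>p Z" "partition_on UNIV Z" "partition_on UNIV Y"
  shows "Z = Y"
proof -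
  have sub: "z \<in> Y"
    if *: "z \<in> Z" "Z \<sqsubseteq>\<^sub>p Y" "Y \<sqsubseteq>\<^sub>p Z" "partition_on UNIV Z" "partition_on UNIV Y"
    for z and Z Y :: "nat set set"
  proof -
    obtain n where n: "n \<in> z"
      using partition_block_nonempty[OF *(4,1)] by blast
    obtain y where y: "y \<in> Y" "n \<in> y"
      using partition_block_ex[OF *(5)] by blast
    have "z = y"
      using coarser_block_subset[OF *(2,4,5,1) y(1) n y(2)]
        coarser_block_subset[OF *(3,5,4) y(1) *(1) y(2) n] by simp
    then show ?thesis using y by simp
  qed
  show ?thesis
    using sub[OF _ assms] sub[OF _ assms(2,1,4,3)] by (intro equalityI subsetI)
qed

text \<open>\<open>finest\<close> is a definite description; antisymmetry of the coarsening order
  gives uniqueness, so a join or a gluing is computed by exhibiting one candidate.\<close>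

lemma finest_eqI:
  assumes "partition_on UNIV Z" "P Z" "\<And>Z'. partition_on UNIV Z' \<Longrightarrow> P Z' \<Longrightarrow> Z' \<sqsubseteq>\<^sub>p Z"
  shows "finest P = Z"
  unfolding finest_def using assms coarser_antisym by (intro the_equality) blast+

lemma coarser_refl: "Z \<sqsubseteq>\<^sub>p Z"
proof -
  have "{b} \<subseteq> Z \<and> b = \<Union>{b}" if "b \<in> Z" for b
    using that by simp
  then show ?thesis unfolding coarser_def by blast
qed

lemma join_eq_left:
  assumes "partition_on UNIV Y" "Y \<sqsubseteq>\<^sub>p X"
  shows "Y \<squnion>\<^sub>p X = Y"
  unfolding join_def using assms coarser_refl by (intro finest_eqI) auto

text \<open>A block of a common coarsening that meets \<open>B\<close> contains \<open>B\<close>,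
  hence meets every fibre of \<open>h\<close> and absorbs it.\<close>

lemma join_fibers_eq_UNIV:
  assumes Y: "partition_on UNIV Y" and h: "surj h" and B: "B \<in> Y"
    and meets: "\<And>v. \<exists>b\<in>B. h b = v"
  shows "Y \<squnion>\<^sub>p fibers h = {UNIV}"
proof -
  have F: "partition_on UNIV (fibers h)"
    using fibers_omega_partition[OF h] by (simp add: omega_partitions_def)
  have one: "{UNIV} \<sqsubseteq>\<^sub>p X" if "partition_on UNIV X" for X :: "nat set set"
    using that unfolding coarser_def partition_on_def by auto
  show ?thesis
    unfolding join_def
  proof (rule finest_eqI)
    show "partition_on UNIV {UNIV :: nat set}"
      by (simp add: partition_on_def)
    show "{UNIV} \<sqsubseteq>\<^sub>p Y \<and> {UNIV} \<sqsubseteq>\<^sub>p fibers h"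
      using one Y F by blast
    fix Z :: "nat set set"
    assume Z: "partition_on UNIV Z" and P: "Z \<sqsubseteq>\<^sub>p Y \<and> Z \<sqsubseteq>\<^sub>p fibers h"
    obtain b where b: "b \<in> B" using meets by blast
    then obtain z where z: "z \<in> Z" "b \<in> z"
      using partition_block_ex[OF Z] by blast
    have Bz: "B \<subseteq> z"
      using coarser_block_subset[of Z Y z B b] P Z Y z B b by blast
    have all: "n \<in> z" for n
    proof -
      obtain c where c: "c \<in> B" "h c = h n" using meets by blast
      have "h -` {h n} \<subseteq> z"
        using coarser_block_subset[of Z "fibers h" z "h -` {h n}" c] P Z F z c Bz
        by (auto simp: fibers_def)
      then show ?thesis by auto
    qed
    then have "z = UNIV" by blast
    then have "y = z" if "y \<in> Z" for y
      using partition_block_nonempty[OF Z that] partition_block_unique[OF Z that z(1)] by blast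
    then have "Z = {UNIV}"
      using z(1) \<open>z = UNIV\<close> by blast
    then show "Z \<sqsubseteq>\<^sub>p {UNIV}"
      using coarser_refl by simp
  qed
qed

lemma not_splits_fibers:
  assumes "partition_on UNIV Y" "surj h" "B \<in> Y" "\<And>v. \<exists>b\<in>B. h b = v"
  shows "\<not> splits Y (fibers h)"
  using join_fibers_eq_UNIV[OF assms]
  by (simp add: splits_def compatible_def omega_partitions_def)

text \<open>Gluing a finite set onto the singletons yields only finite blocks, and none of them can
  contain the infinite block \<open>a\<close>.\<close>

lemma infinite_block_nontrivial:
  assumes X: "partition_on UNIV X" and a: "a \<in> X" "infinite a"
  shows "\<not> trivial_partition X"
proof
  let ?S = "range (\<lambda>n::nat. {n})"
  assume "trivial_partition X"
  then obtain f where f: "finite f" "glue ?S f \<sqsubseteq>\<^sub>p X"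
    unfolding trivial_partition_def almost_equal_def almost_coarser_def by blast
  \<comment> \<open>The explicit form of the gluing; removing \<open>{}\<close> covers the case
    \<open>f = {}\<close>, where only the singletons remain.\<close>
  define G where "G = insert f ((\<lambda>n. {n}) ` (- f)) - {{}}"
  have part: "partition_on UNIV G"
    unfolding G_def partition_on_def disjoint_def by auto
  have "glue ?S f = G"
    unfolding glue_def
  proof (rule finest_eqI[OF part])
    have "\<exists>S\<subseteq>?S. b = \<Union>S" for b :: "nat set"
      by (rule exI[of _ "(\<lambda>n. {n}) ` b"]) auto
    moreover have "\<exists>b\<in>G. f \<subseteq> b"
    proof (cases "f = {}")
      case True
      then have "{0} \<in> G" unfolding G_def by simp
      then show ?thesis using True by blast
    qed (auto simp: G_def)
    ultimately show "G \<sqsubseteq>\<^sub>p ?S \<and> (\<exists>b\<in>G. f \<subseteq> b)"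
      unfolding coarser_def by blast
  next
    fix Z assume Z: "partition_on UNIV Z" and P: "Z \<sqsubseteq>\<^sub>p ?S \<and> (\<exists>b\<in>Z. f \<subseteq> b)"
    obtain c where c: "c \<in> Z" "f \<subseteq> c" using P by blast
    show "Z \<sqsubseteq>\<^sub>p G"
      unfolding coarser_def
    proof (intro ballI exI conjI)
      fix b assume b: "b \<in> Z"
      let ?T = "{g \<in> G. g \<subseteq> b}"
      show "?T \<subseteq> G" by blast
      have "x \<in> \<Union>?T" if "x \<in> b" for x
      proof (cases "x \<in> f")
        case True
        then have "b = c"
          using that b c partition_block_unique[OF Z, of b c x] by blast
        then show ?thesis using True c unfolding G_def by blast
      next
        case False
        then have "{x} \<in> ?T" using that unfolding G_def by auto
        then show ?thesis by blast
      qed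
      then show "b = \<Union>?T" by blast
    qed
  qed
  then have GX: "G \<sqsubseteq>\<^sub>p X" using f by simp
  obtain n where n: "n \<in> a" using a by fastforce
  obtain g where g: "g \<in> G" "n \<in> g"
    using partition_block_ex[OF part] by blast
  have "a \<subseteq> g"
    using coarser_block_subset[OF GX part X g(1) a(1) g(2) n] .
  moreover have "finite g"
    using g f unfolding G_def by auto
  ultimately show False using a finite_subset by blast
qed

text \<open>The position of \<open>n\<close> in its own fibre is the number of smaller arguments
  with the same value. An infinite fibre selects the first case of \<open>perp\<close>, so the dual
  is again a partition into fibres.\<close>

lemma perp_fibers:
  assumes "infinite (h -` {v})"
  shows "perp (fibers h) = fibers (\<lambda>n. card {m. m < n \<and> h m = h n})"
proof -
  have inf: "\<exists>b\<in>fibers h. infinite b"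
    using assms unfolding fibers_def by blast
  have "{m \<in> h -` {h n}. m < n} = {m. m < n \<and> h m = h n}" for n
    by auto
  then have "{n. \<exists>b\<in>fibers h. n \<in> b \<and> card {m\<in>b. m < n} = i}
      = (\<lambda>n. card {m. m < n \<and> h m = h n}) -` {i}" for i
    by (auto simp: fibers_def)
  then show ?thesis
    using inf unfolding perp_def fibers_def[of "\<lambda>n. card {m. m < n \<and> h m = h n}"] by simp
qed

section \<open>Existence of weak splitting families\<close>

text \<open>This makes weak splitting families exist, so that \<open>weak_splitting_number\<close>
  is the size of an actual family and not the result of an arbitrary choice.\<close>

lemma ex_splitting_partition:
  assumes X: "X \<in> omega_partitions"
  shows "\<exists>Y\<in>omega_partitions_inf. splits Y X"
proof -
  have part: "partition_on UNIV X" and inf: "infinite X"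
    using X by (auto simp: omega_partitions_def)
  have "inj_on (\<lambda>b. LEAST n. n \<in> b) X"
  proof (rule inj_onI)
    fix a b assume ab: "a \<in> X" "b \<in> X" "(LEAST n. n \<in> a) = (LEAST n. n \<in> b)"
    have "(LEAST n. n \<in> c) \<in> c" if "c \<in> X" for c
    proof -
      show ?thesis
        using partition_block_nonempty[OF part that] by (rule LeastI_ex)
    qed
    then show "a = b"
      using ab partition_block_unique[OF part ab(1,2)] by metis
  qed
  then have "countable X"
    by (rule countableI)
  then have bij: "bij_betw (to_nat_on X) X UNIV"
    using inf by (rule to_nat_on_infinite)
  define blk where "blk n = (THE b. b \<in> X \<and> n \<in> b)" for n
  have blk_eq: "blk n = b" if "b \<in> X" "n \<in> b" for n b
    unfolding blk_def
    using that partition_block_unique[OF part] by (intro the_equality) blast+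
  \<comment> \<open>Numbering the blocks presents \<open>X\<close> as the fibres of
    \<open>h\<close>, so composing any function with \<open>h\<close> gives fibres that are unions
    of blocks of \<open>X\<close>.\<close>
  define h where "h n = to_nat_on X (blk n)" for n
  have h_block: "b = h -` {to_nat_on X b}" if b: "b \<in> X" for b
  proof
    show "b \<subseteq> h -` {to_nat_on X b}"
      using b blk_eq by (auto simp: h_def)
    show "h -` {to_nat_on X b} \<subseteq> b"
    proof
      fix n assume n: "n \<in> h -` {to_nat_on X b}"
      obtain c where c: "c \<in> X" "n \<in> c"
        using partition_block_ex[OF part] by blast
      then have "to_nat_on X c = to_nat_on X b"
        using n blk_eq by (simp add: h_def)
      then have "c = b"
        using bij b c by (metis bij_betw_imp_inj_on inj_onD)
      then show "n \<in> b" using c by simp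
    qed
  qed
  have fib_X: "h -` {v} \<in> X" for v
  proof -
    obtain b where "b \<in> X" "to_nat_on X b = v"
      using bij by (metis UNIV_I bij_betw_imp_surj_on imageE)
    then show ?thesis using h_block by auto
  qed
  have surj_h: "surj h"
  proof -
    have "\<exists>n. h n = v" for v
    proof -
      show ?thesis
        using partition_block_nonempty[OF part fib_X[of v]] by blast
    qed
    then show ?thesis unfolding surj_def by metis
  qed
  have coarse: "fibers (g \<circ> h) \<sqsubseteq>\<^sub>p X" for g
    unfolding coarser_def
  proof (intro ballI exI conjI)
    fix b assume b: "b \<in> fibers (g \<circ> h)"
    let ?T = "{a \<in> X. a \<subseteq> b}"
    show "?T \<subseteq> X" by blast
    have "n \<in> \<Union>?T" if "n \<in> b" for n
    proof -
      have "h -` {h n} \<subseteq> b" using b that by (auto simp: fibers_def)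
      then have "h -` {h n} \<in> ?T" using fib_X by blast
      then show ?thesis by (metis UnionI vimage_singleton_eq)
    qed
    then show "b = \<Union>?T" by blast
  qed
  \<comment> \<open>Identify the quotient by \<open>X\<close> with a square grid; its rows and its columns are orthogonal.\<close>
  define row where "row = (\<lambda>k. fst (prod_decode k)) \<circ> h"
  define col where "col = (\<lambda>k. snd (prod_decode k)) \<circ> h"
  have grid: "\<exists>n. row n = i \<and> col n = j" for i j
  proof -
    obtain n where n: "prod_encode (i, j) = h n"
      using surjD[OF surj_h] by blast
    have "row n = i \<and> col n = j"
      unfolding row_def col_def comp_def n[symmetric] by simp
    then show ?thesis by blast
  qed
  have surjs: "surj row" "surj col"
    unfolding surj_def using grid by metis+
  have Y: "fibers row \<in> omega_partitions" and Z: "fibers col \<in> omega_partitions"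
    using surjs fibers_omega_partition by blast+
  have "j \<in> col ` (row -` {0})" for j
    using grid[of 0 j] by auto
  then have image: "col ` (row -` {0}) = UNIV" by blast
  have "infinite (row -` {0})"
    using image by (metis finite_imageI infinite_UNIV_nat)
  then have Yinf: "fibers row \<in> omega_partitions_inf"
    using Y by (auto simp: omega_partitions_inf_def fibers_def)
  have "fibers row \<squnion>\<^sub>p fibers col = {UNIV}"
  proof (rule join_fibers_eq_UNIV)
    show "partition_on UNIV (fibers row)"
      using Y by (simp add: omega_partitions_def)
    show "row -` {0} \<in> fibers row"
      by (simp add: fibers_def)
    show "\<exists>b\<in>row -` {0}. col b = j" for j
      using grid[of 0 j] by auto
  qed (rule surjs)
  moreover have "fibers row \<squnion>\<^sub>p X = fibers row"
    using join_eq_left coarse Y unfolding row_def omega_partitions_def by blast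
  moreover have "fibers col \<sqsubseteq>\<^sub>p X"
    unfolding col_def by (rule coarse)
  ultimately have "splits (fibers row) X"
    using Y Z unfolding splits_def compatible_def orthogonal_partitions_def by auto
  then show ?thesis using Yinf by blast
qed

lemma weak_splitting_omega_partitions_inf: "weak_splitting omega_partitions_inf"
  unfolding weak_splitting_def using ex_splitting_partition by blast

text \<open>A partition with an infinite block is non-trivial, so some member must handle it. In the
  covering argument, one member is needed to see that a generic sequence has infinite fibres at
  all.\<close>

lemma weak_splitting_nonempty:
  assumes "weak_splitting W"
  shows "W \<noteq> {}"
proof -
  define h where "h n = fst (prod_decode n)" for n
  have val: "h (prod_encode (i, j)) = i" for i j
    by (simp add: h_def)
  then have "surj h" unfolding surj_def by metis
  then have h: "fibers h \<in> omega_partitions"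
    by (rule fibers_omega_partition)
  have "infinite (h -` {0})"
  proof -
    have "range (\<lambda>j. prod_encode (0, j)) \<subseteq> h -` {0}"
      using val by auto
    moreover have "inj (\<lambda>j. prod_encode (0, j))"
      by (auto intro: injI)
    ultimately show ?thesis
      by (meson infinite_super range_inj_infinite)
  qed
  then have "\<not> trivial_partition (fibers h)"
    using h infinite_block_nontrivial[of "fibers h" "h -` {0}"]
    by (auto simp: omega_partitions_def fibers_def)
  then show ?thesis
    using assms h unfolding weak_splitting_def by blast
qed

section \<open>Generic sequences read off the digits of a real number\<close>

text \<open>For \<open>n > 0\<close> this is the \<open>n\<close>-th binary digit after the point,
  for \<open>n = 0\<close> the parity of the floor; negative \<open>x\<close> are included.\<close>

definition digit :: "real \<Rightarrow> nat \<Rightarrow> bool" where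
  "digit x n \<longleftrightarrow> odd \<lfloor>2 ^ n * x\<rfloor>"

text \<open>The pairing function arranges the bits in rows, and row \<open>n\<close> codes the place
  of its first true bit. A row without true bits has an unspecified value; the open sets built below
  fix a true bit in each row whose value they prescribe.\<close>

definition decode :: "(nat \<Rightarrow> bool) \<Rightarrow> nat \<Rightarrow> nat" where
  "decode c n = (LEAST k. c (prod_encode (n, k)))"

section \<open>Binary digits and dyadic intervals\<close>

lemma floor_double_div: "\<lfloor>2 ^ Suc n * x\<rfloor> div 2 = \<lfloor>2 ^ n * (x::real)\<rfloor>"
proof -
  have "\<lfloor>2 ^ n * x\<rfloor> = \<lfloor>(2 ^ Suc n * x) / real_of_int 2\<rfloor>"
    by simp
  also have "\<dots> = \<lfloor>2 ^ Suc n * x\<rfloor> div 2"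
    by (subst floor_divide_real_eq_div) auto
  finally show ?thesis by simp
qed

lemma floor_power_div: "\<lfloor>2 ^ (n + d) * x\<rfloor> div 2 ^ d = \<lfloor>2 ^ n * (x::real)\<rfloor>"
proof (induction d)
  case (Suc d)
  have "\<lfloor>2 ^ (n + Suc d) * x\<rfloor> div 2 ^ Suc d = \<lfloor>2 ^ Suc (n + d) * x\<rfloor> div 2 div 2 ^ d"
    by (simp add: zdiv_zmult2_eq)
  then show ?case
    using Suc by (simp only: floor_double_div)
qed simp

text \<open>The left half of a dyadic interval has even index and the right half odd index, so each
  halving prescribes one more digit.\<close>

lemma extend_digits:
  "\<exists>k'. \<forall>x. \<lfloor>2 ^ (N + d) * x\<rfloor> = k' \<longrightarrow>
      \<lfloor>2 ^ N * x\<rfloor> = k \<and> (\<forall>n. N < n \<and> n \<le> N + d \<longrightarrow> digit x n = c n)"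
proof (induction d)
  case 0
  show ?case by auto
next
  case (Suc d)
  then obtain k' where k': "\<And>x. \<lfloor>2 ^ (N + d) * x\<rfloor> = k' \<Longrightarrow>
      \<lfloor>2 ^ N * x\<rfloor> = k \<and> (\<forall>n. N < n \<and> n \<le> N + d \<longrightarrow> digit x n = c n)"
    by blast
  let ?k = "2 * k' + (if c (N + Suc d) then 1 else 0)"
  show ?case
  proof (intro exI[of _ ?k] allI impI)
    fix x :: real
    assume x: "\<lfloor>2 ^ (N + Suc d) * x\<rfloor> = ?k"
    have "\<lfloor>2 ^ (N + d) * x\<rfloor> = k'"
      using floor_double_div[of "N + d" x] x by (auto split: if_splits)
    moreover have "digit x (N + Suc d) = c (N + Suc d)"
      unfolding digit_def x by auto
    ultimately show "\<lfloor>2 ^ N * x\<rfloor> = k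
        \<and> (\<forall>n. N < n \<and> n \<le> N + Suc d \<longrightarrow> digit x n = c n)"
      using k'[of x] by (auto simp: le_Suc_eq)
  qed
qed

lemma open_contains_dyadic:
  assumes "open U" "U \<noteq> ({} :: real set)"
  shows "\<exists>N k. \<forall>x. \<lfloor>2 ^ N * x\<rfloor> = k \<longrightarrow> x \<in> U"
proof -
  obtain a where a: "a \<in> U" using assms by blast
  obtain e where e: "e > 0" "ball a e \<subseteq> U"
    using assms a by (meson openE)
  obtain N where N: "(1/2::real) ^ N < e"
    using real_arch_pow_inv[of e "1/2"] e by auto
  have "x \<in> U" if "\<lfloor>2 ^ N * x\<rfloor> = \<lfloor>2 ^ N * a\<rfloor>" for x
  proof -
    have "\<bar>2 ^ N * x - 2 ^ N * a\<bar> < 1"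
      using that by linarith
    moreover have "2 ^ N * x - 2 ^ N * a = 2 ^ N * (x - a)"
      by (simp add: right_diff_distrib)
    ultimately have "2 ^ N * \<bar>x - a\<bar> < 1"
      by (simp add: abs_mult)
    then have "\<bar>x - a\<bar> < (1/2) ^ N"
      by (simp add: power_one_over pos_less_divide_eq mult.commute)
    then have "x \<in> ball a e"
      using N by (simp add: dist_real_def)
    then show ?thesis using e by blast
  qed
  then show ?thesis
    by (intro exI[of _ N] exI[of _ "\<lfloor>2 ^ N * a\<rfloor>"] allI impI)
qed

text \<open>The dyadic cell is half-open; its interior serves as \<open>V\<close>.\<close>

lemma floor_cell_contains_open:
  "\<exists>V. open V \<and> V \<noteq> {} \<and> (\<forall>x\<in>V. \<lfloor>2 ^ M * (x::real)\<rfloor> = k)"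
proof (intro exI conjI ballI)
  let ?V = "{of_int k / 2 ^ M <..< (of_int k + 1) / (2::real) ^ M}"
  show "open ?V" by simp
  show "?V \<noteq> {}" by (simp add: divide_strict_right_mono not_le)
  show "\<lfloor>2 ^ M * x\<rfloor> = k" if "x \<in> ?V" for x
  proof (rule floor_unique)
    have "of_int k < x * 2 ^ M" "x * 2 ^ M < of_int k + 1"
      using that by (simp_all add: pos_divide_less_eq pos_less_divide_eq)
    then show "of_int k \<le> 2 ^ M * x" "2 ^ M * x < of_int k + 1"
      by (simp_all add: mult.commute)
  qed
qed

text \<open>Pairing is monotone in the second coordinate, so the bits of row \<open>n\<close> up to
  its first true one all have codes within the stated bound. Finitely many bits thus decide a
  value.\<close>

lemma decode_cong:
  assumes "c (prod_encode (n, k))"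
    and "\<And>p. p \<le> prod_encode (n, decode c n) \<Longrightarrow> c' p = c p"
  shows "decode c' n = decode c n"
proof -
  have mono: "prod_encode (n, i) \<le> prod_encode (n, j)" if "i \<le> j" for i j
    using that lift_Suc_mono_le[of triangle "n + i" "n + j"] by (simp add: prod_encode_def)
  have holds: "c (prod_encode (n, decode c n))"
    unfolding decode_def using assms(1) by (rule LeastI)
  show ?thesis
    unfolding decode_def[of c']
  proof (rule Least_equality)
    show "c' (prod_encode (n, decode c n))"
      using holds assms(2) by blast
    fix j assume j: "c' (prod_encode (n, j))"
    show "decode c n \<le> j"
    proof (rule ccontr)
      assume "\<not> decode c n \<le> j"
      then have lt: "j < decode c n" by simp
      then have "c (prod_encode (n, j))"
        using j assms(2) mono[of j "decode c n"] by simp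
      then show False
        using lt unfolding decode_def by (auto dest: not_less_Least)
    qed
  qed
qed

text \<open>Every nonempty open set decides only an initial segment of the decoded sequence and leaves
  the rest free, as in the Baire space.\<close>

lemma extend_decoded:
  assumes "open U" "U \<noteq> ({} :: real set)"
  shows "\<exists>N s. \<forall>e M. \<exists>V. open V \<and> V \<noteq> {} \<and> V \<subseteq> U \<and>
    (\<forall>x\<in>V. (\<forall>n<N. decode (digit x) n = s n) \<and>
            (\<forall>n. N \<le> n \<and> n < M \<longrightarrow> decode (digit x) n = e n))"
proof -
  from open_contains_dyadic[OF assms]
  obtain N k where Nk: "\<forall>x. \<lfloor>2 ^ N * x\<rfloor> = k \<longrightarrow> x \<in> U"
    by (elim exE)
  \<comment> \<open>Dropping the last \<open>N - p\<close> binary digits of the cell index recovers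
    the digit at \<open>p\<close>.\<close>
  define d0 where "d0 p = odd (k div 2 ^ (N - p))" for p
  have d0: "digit x p = d0 p" if "\<lfloor>2 ^ N * x\<rfloor> = k" "p \<le> N" for x p
    using floor_power_div[of p "N - p" x] that by (simp add: digit_def d0_def)
  \<comment> \<open>Filling up with true bits makes the first values independent of \<open>e\<close>
    and \<open>M\<close>, as the order of the quantifiers requires.\<close>
  define c0 where "c0 p = (if p \<le> N then d0 p else True)" for p
  have "\<exists>V. open V \<and> V \<noteq> {} \<and> V \<subseteq> U \<and>
      (\<forall>x\<in>V. (\<forall>n<Suc N. decode (digit x) n = decode c0 n) \<and>
        (\<forall>n. Suc N \<le> n \<and> n < M \<longrightarrow> decode (digit x) n = e n))" for e M
  proof -
    \<comment> \<open>A pair's code is at least its first component, so rows beyond \<open>N\<close>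
      contain no position up to \<open>N\<close> and can be given a single true bit, in column
      \<open>e n\<close>.\<close>
    define c where "c p = (if p \<le> N then d0 p else
        if fst (prod_decode p) \<le> N then True
        else snd (prod_decode p) = e (fst (prod_decode p)))" for p
    have c_small: "decode c n = decode c0 n" if "n \<le> N" for n
      using that unfolding decode_def c_def c0_def by simp
    have c_large: "c (prod_encode (n, j)) \<longleftrightarrow> j = e n" if "N < n" for n j
      using that le_prod_encode_1[of n j] unfolding c_def by simp
    have dec_large: "decode c n = e n" if "N < n" for n
      unfolding decode_def c_large[OF that] by (rule Least_equality) auto
    have ex: "\<exists>j. c (prod_encode (n, j))" for n
    proof (cases "N < n")
      case False
      then have "c (prod_encode (n, Suc N))"
        using le_prod_encode_2[of "Suc N" n] unfolding c_def by simp
      then show ?thesis by blast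
    qed (use c_large in blast)
    \<comment> \<open>The sum merely bounds all positions that decide the first
      \<open>Suc N + M\<close> values.\<close>
    define D where "D = (\<Sum>n<Suc N + M. prod_encode (n, decode c n))"
    have D: "prod_encode (n, decode c n) \<le> D" if "n < Suc N + M" for n
      unfolding D_def using that
      by (intro member_le_sum[where f = "\<lambda>n. prod_encode (n, decode c n)"]) auto
    from extend_digits[of N D k c]
    obtain k' where k': "\<forall>x. \<lfloor>2 ^ (N + D) * x\<rfloor> = k' \<longrightarrow>
        \<lfloor>2 ^ N * x\<rfloor> = k \<and> (\<forall>n. N < n \<and> n \<le> N + D \<longrightarrow> digit x n = c n)"
      by (elim exE)
    from floor_cell_contains_open[of "N + D" k']
    obtain V :: "real set" where V: "open V" "V \<noteq> {}" "\<forall>x\<in>V. \<lfloor>2 ^ (N + D) * x\<rfloor> = k'"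
      by (elim exE conjE)
    have cell: "\<lfloor>2 ^ N * x\<rfloor> = k" "\<And>n. N < n \<Longrightarrow> n \<le> N + D \<Longrightarrow> digit x n = c n" if "x \<in> V" for x
      using k'[THEN spec, THEN mp, OF V(3)[THEN bspec, OF that]] by simp_all
    have "digit x p = c p" if "x \<in> V" "p \<le> D" for x p
    proof (cases "p \<le> N")
      case True
      then show ?thesis using d0[OF cell(1)[OF that(1)]] by (simp add: c_def)
    qed (use cell(2)[OF that(1)] that(2) in simp)
    then have dec: "decode (digit x) n = decode c n" if "x \<in> V" "n < Suc N + M" for x n
      using ex[of n] D[OF that(2)] that(1) by (elim exE) (rule decode_cong, assumption, simp)
    have "V \<subseteq> U" using cell(1) Nk by blast
    then show ?thesis
      using V(1,2) dec c_small dec_large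
      by (intro exI[of _ V] conjI ballI allI impI) simp_all
  qed
  then show ?thesis
    by (intro exI[of _ "Suc N"] exI[of _ "decode c0"] allI)
qed

section \<open>Nowhere density of the failures of genericity\<close>

lemma nowhere_denseI:
  assumes "\<And>U. open U \<Longrightarrow> U \<noteq> {} \<Longrightarrow> \<exists>V. open V \<and> V \<noteq> {} \<and> V \<subseteq> U \<and> V \<inter> A = {}"
  shows "nowhere_dense A"
proof (rule ccontr)
  assume "\<not> nowhere_dense A"
  then obtain V where "open V" "V \<noteq> {}" "V \<subseteq> interior (closure A)" "V \<inter> A = {}"
    using assms[of "interior (closure A)"] unfolding nowhere_dense_def by auto
  then show False
    using open_Int_closure_eq_empty[of V A] interior_subset[of "closure A"] by blast
qed

text \<open>\<open>U\<close> leaves the sequence free from some \<open>N\<close> on, and the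
  infinite set \<open>B\<close> has a point there at which to prescribe \<open>v\<close>.\<close>

lemma nowhere_dense_value:
  assumes "infinite B"
  shows "nowhere_dense {x. \<not> (\<exists>b\<in>B. decode (digit x) b = v)}"
proof (rule nowhere_denseI)
  fix U :: "real set" assume "open U" "U \<noteq> {}"
  from extend_decoded[OF this] obtain N s where N: "\<forall>e M. \<exists>V. open V \<and> V \<noteq> {} \<and> V \<subseteq> U \<and>
    (\<forall>x\<in>V. (\<forall>n<N. decode (digit x) n = s n) \<and>
            (\<forall>n. N \<le> n \<and> n < M \<longrightarrow> decode (digit x) n = e n))"
    by (elim exE)
  obtain b where b: "b \<in> B" "N \<le> b"
    using assms by (metis infinite_nat_iff_unbounded_le)
  obtain V where V: "open V" "V \<noteq> {}" "V \<subseteq> U"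
    and dec: "\<forall>x\<in>V. (\<forall>n<N. decode (digit x) n = s n) \<and>
            (\<forall>n. N \<le> n \<and> n < Suc b \<longrightarrow> decode (digit x) n = v)"
    using N[THEN spec[of _ "\<lambda>_. v"], THEN spec[of _ "Suc b"]] by (elim exE conjE)
  have "decode (digit x) b = v" if "x \<in> V" for x
    using dec that b(2) by simp
  then show "\<exists>V. open V \<and> V \<noteq> {} \<and> V \<subseteq> U \<and> V \<inter> {x. \<not> (\<exists>b\<in>B. decode (digit x) b = v)} = {}"
    using V b(1) by (intro exI[of _ V]) auto
qed

lemma nowhere_dense_rank:
  assumes "infinite B"
  shows "nowhere_dense
    {x. \<not> (\<exists>b\<in>B. card {m. m < b \<and> decode (digit x) m = decode (digit x) b} = i)}"
proof (rule nowhere_denseI)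
  fix U :: "real set" assume "open U" "U \<noteq> {}"
  from extend_decoded[OF this] obtain N s where N: "\<forall>e M. \<exists>V. open V \<and> V \<noteq> {} \<and> V \<subseteq> U \<and>
    (\<forall>x\<in>V. (\<forall>n<N. decode (digit x) n = s n) \<and>
            (\<forall>n. N \<le> n \<and> n < M \<longrightarrow> decode (digit x) n = e n))"
    by (elim exE)
  \<comment> \<open>The bound \<open>N + i\<close> leaves room for \<open>i\<close> earlier copies
    of the value.\<close>
  obtain b where b: "b \<in> B" "N + i \<le> b"
    using assms by (metis infinite_nat_iff_unbounded_le)
  from ex_new_if_finite[OF infinite_UNIV_nat finite_imageI[OF finite_lessThan], of s N]
  obtain v where v: "v \<notin> s ` {..<N}"
    by (elim exE)
  \<comment> \<open>The fresh value \<open>v\<close> is taken exactly \<open>i\<close> times before \<open>b\<close>.\<close>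
  define e where "e n = (if n < N + i \<or> n = b then v else Suc v)" for n
  obtain V where V: "open V" "V \<noteq> {}" "V \<subseteq> U"
    and V_dec: "\<forall>x\<in>V. (\<forall>n<N. decode (digit x) n = s n) \<and>
            (\<forall>n. N \<le> n \<and> n < Suc b \<longrightarrow> decode (digit x) n = e n)"
    using N[THEN spec[of _ e], THEN spec[of _ "Suc b"]] by (elim exE conjE)
  have "card {m. m < b \<and> decode (digit x) m = decode (digit x) b} = i" if x: "x \<in> V" for x
  proof -
    note dec = V_dec[THEN bspec, OF x]
    have fresh: "decode (digit x) n \<noteq> v" if "n < N" for n
      using conjunct1[OF dec] that v by force
    have e: "decode (digit x) n = e n" if "N \<le> n" "n \<le> b" for n
      using conjunct2[OF dec] that by simp
    have vb: "decode (digit x) b = v"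
      using e[of b] b(2) by (simp add: e_def)
    have "m < b \<and> decode (digit x) m = v \<longleftrightarrow> N \<le> m \<and> m < N + i" for m
    proof (cases "m < N")
      case True
      then show ?thesis using fresh by simp
    next
      case False
      then show ?thesis
        using e[of m] b(2) by (cases "m < b"; cases "m < N + i") (simp_all add: e_def)
    qed
    then have eq: "{m. m < b \<and> decode (digit x) m = decode (digit x) b} = {N..<N + i}"
      unfolding vb set_eq_iff mem_Collect_eq atLeastLessThan_iff by (rule allI)
    show ?thesis unfolding eq by simp
  qed
  then have rank: "\<exists>b\<in>B. card {m. m < b \<and> decode (digit x) m = decode (digit x) b} = i"
    if "x \<in> V" for x
    using that by (intro bexI[OF _ b(1)])
  show "\<exists>V. open V \<and> V \<noteq> {} \<and> V \<subseteq> U \<and> V \<inter> {x. \<not> (\<exists>b\<in>B.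
      card {m. m < b \<and> decode (digit x) m = decode (digit x) b} = i)} = {}"
  proof (intro exI conjI)
    show "V \<inter> {x. \<not> (\<exists>b\<in>B.
        card {m. m < b \<and> decode (digit x) m = decode (digit x) b} = i)} = {}"
      using rank by (simp add: disjoint_iff)
    show "open V" "V \<noteq> {}" "V \<subseteq> U"
      by (fact V)+
  qed
qed

text \<open>Outside this set the tails \<open>{n..}\<close> make every value occur infinitely often:
  infinite fibres give non-triviality and select the first case of \<open>perp\<close>. The second
  union concerns the blocks of the dual.\<close>

definition non_generic :: "nat set \<Rightarrow> real set" where
  "non_generic B = (\<Union>(n, v). {x. \<not> (\<exists>b\<in>B \<inter> {n..}. decode (digit x) b = v)}) \<union>
     (\<Union>i. {x. \<not> (\<exists>b\<in>B. card {m. m < b \<and> decode (digit x) m = decode (digit x) b} = i)})"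

lemma meager_non_generic:
  assumes "infinite B"
  shows "meager (non_generic B)"
proof -
  have "infinite (B \<inter> {n..})" for n
  proof
    assume "finite (B \<inter> {n..})"
    then have "finite (B \<inter> {n..} \<union> {..<n})" by simp
    then have "finite B" by (rule rev_finite_subset) auto
    then show False using assms by simp
  qed
  then show ?thesis
    unfolding meager_def non_generic_def
    using nowhere_dense_value nowhere_dense_rank[OF assms]
    by (intro exI[of _ "range (\<lambda>(n, v). {x. \<not> (\<exists>b\<in>B \<inter> {n..}. decode (digit x) b = v)}) \<union>
      range (\<lambda>i. {x. \<not> (\<exists>b\<in>B.
        card {m. m < b \<and> decode (digit x) m = decode (digit x) b} = i)})"]) auto
qed

section \<open>The inequality\<close>

text \<open>Choosing one infinite block in each member attaches one meager set to it, so the cover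
  is no larger than \<open>W\<close>.\<close>

lemma weak_splitting_meager_cover:
  assumes W: "weak_splitting W"
  shows "\<exists>F. (\<forall>A\<in>F. meager A) \<and> \<Union>F = (UNIV :: real set) \<and> |F| \<le>o |W|"
proof -
  have "\<exists>b. b \<in> Y \<and> infinite b" if "Y \<in> W" for Y
    using that W unfolding weak_splitting_def omega_partitions_inf_def by blast
  then obtain B where B: "\<And>Y. Y \<in> W \<Longrightarrow> B Y \<in> Y \<and> infinite (B Y)"
    by metis
  let ?F = "(\<lambda>Y. non_generic (B Y)) ` W"
  have "x \<in> \<Union>?F" for x
  proof (rule ccontr)
    assume x: "x \<notin> \<Union>?F"
    define f where "f = decode (digit x)"
    define g where "g n = card {m. m < n \<and> f m = f n}" for n
    have f: "\<exists>b\<in>B Y. n \<le> b \<and> f b = v" and g: "\<exists>b\<in>B Y. g b = v" if "Y \<in> W" for Y n v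
    proof -
      have "x \<notin> non_generic (B Y)" using x that by blast
      then have "\<exists>b\<in>B Y \<inter> {n..}. f b = v" "\<exists>b\<in>B Y. g b = v"
        unfolding non_generic_def f_def g_def by auto
      then show "\<exists>b\<in>B Y. n \<le> b \<and> f b = v" "\<exists>b\<in>B Y. g b = v"
        by auto
    qed
    obtain Y0 where Y0: "Y0 \<in> W" using weak_splitting_nonempty[OF W] by blast
    have inf: "infinite (f -` {v})" for v
      unfolding infinite_nat_iff_unbounded_le using f[OF Y0] by blast
    have surj: "surj f" "surj g"
      unfolding surj_def using f[OF Y0] g[OF Y0] by metis+
    have X: "fibers f \<in> omega_partitions"
      using surj fibers_omega_partition by blast
    then have "\<not> trivial_partition (fibers f)"
      using infinite_block_nontrivial[of "fibers f" "f -` {0}"] inf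
      by (auto simp: omega_partitions_def fibers_def)
    then obtain Y where Y: "Y \<in> W" "splits Y (fibers f) \<or> splits Y (perp (fibers f))"
      using W X unfolding weak_splitting_def by blast
    have part: "partition_on UNIV Y"
      using Y W unfolding weak_splitting_def omega_partitions_inf_def omega_partitions_def by blast
    have "perp (fibers f) = fibers g"
      using perp_fibers[OF inf] unfolding g_def .
    moreover have "\<not> splits Y (fibers f)"
      using not_splits_fibers[OF part surj(1)] B[OF Y(1)] f[OF Y(1)] by blast
    moreover have "\<not> splits Y (fibers g)"
      using not_splits_fibers[OF part surj(2)] B[OF Y(1)] g[OF Y(1)] by blast
    ultimately show False using Y by simp
  qed
  then have "\<Union>?F = UNIV" by blast
  then show ?thesis
    using meager_non_generic B card_of_image by (intro exI[of _ ?F] conjI) auto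
qed

text \<open>Cardinals are well-ordered, so the choice in \<open>least_size\<close> meets its
  specification as soon as \<open>C\<close> is nonempty.\<close>

lemma least_size_attained:
  assumes "C \<noteq> {}"
  shows "\<exists>A\<in>C. least_size C = |A| \<and> (\<forall>B\<in>C. |A| \<le>o |B| )"
proof -
  have "\<exists>r\<in>card_of ` C. \<forall>r'\<in>card_of ` C. r \<le>o r'"
    using assms by (intro exists_minim_Card_order) (auto simp: card_of_Card_order)
  then have "\<exists>A. A \<in> C \<and> (\<forall>B\<in>C. |A| \<le>o |B| )" by blast
  from someI_ex[OF this] show ?thesis
    unfolding least_size_def by blast
qed

lemma least_size_le:
  assumes "B \<in> C"
  shows "least_size C \<le>o |B|"
proof -
  have "C \<noteq> {}" using assms by auto
  then show ?thesis
    using least_size_attained[of C] assms by auto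
qed

theorem mainTheorem13:
  shows "cov_meager \<le>o weak_splitting_number"
proof -
  have "{W. weak_splitting W} \<noteq> {}"
    using weak_splitting_omega_partitions_inf by auto
  from least_size_attained[OF this]
  obtain W where W: "weak_splitting W" "weak_splitting_number = |W|"
    unfolding weak_splitting_number_def by auto
  from weak_splitting_meager_cover[OF W(1)]
  obtain F where F: "\<forall>A\<in>F. meager A" "\<Union>F = (UNIV :: real set)" "|F| \<le>o |W|"
    by (elim exE conjE)
  have "cov_meager \<le>o |F|"
    unfolding cov_meager_def by (rule least_size_le) (simp add: F(1,2))
  then show ?thesis
    unfolding W(2) using F(3) by (rule ordLeq_transitive)
qed

end
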